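(* Let $S$ be a binary coherent system with $n$ components that is strongly stable with respect to the usual ordering $1<2<\cdots<n$ of the components. Let $\mathbf{p}=(p_1,\dots,p_n)\in[0,1]^n$ be a vector of working probabilities, let $j<i$, and let $\mathbf{p}'=(p_1,\dots,\overset{j}{p_i},\dots,\overset{i}{p_j},\dots,p_n)$ be the vector obtained from $\mathbf{p}$ by interchanging the working probabilities of components $i$ and $j$. Then $$p_i\ge p_j \implies R_{\mathbf{p}'}(S)\ge R_{\mathbf{p}}(S).$$
   Context: A binary system has components $c_1,\dots,c_n$ each with states $\{0,1\}$ (failed/working) and structure function $\Phi:\{0,1\}^n\to\{0,1\}$. It is coherent if $\Phi$ is non-decreasing for the componentwise order and each component is relevant (its state does affect the system state). A path (working state) is a tuple $s\in\{0,1\}^n$ with $\Phi(s)=1$. The binary system is strongly stable with respect to the ordering $1<2<\cdots<n$ if for every path $m=(m_1,\dots,m_n)$ and all $j<i$ with $m_i=1$ and $m_j=0$, the tuple obtained from $m$ by replacing $m_i$ by $0$ and $m_j$ by $1$ is also a path. For $\mathbf{p}=(p_1,\dots,p_n)$, the components are assumed to work independently, with $p_k$ the probability that component $c_k$ works, and $R_{\mathbf{p}}(S)$ (the reliability of $S$ using $\mathbf{p}$) is the probability that the random state $(c_1,\dots,c_n)$ satisfies $\Phi(c_1,\dots,c_n)=1$. *)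

theory Defs
  imports "HOL-Probability.Product_PMF"
begin

(* A tuple in {0,1}^n is a function nat => bool (False = 0 = failed, True = 1 = working),
   indexed by {1..n} and fixed to False outside, so that the library order on functions
   is the componentwise order. A system with n components is given by n and its structure
   function, whose values outside states n are irrelevant. *)

definition states :: "nat \<Rightarrow> (nat \<Rightarrow> bool) set" where
  "states n = PiE_dflt {1..n} False (\<lambda>_. UNIV)"

definition relevant :: "nat \<Rightarrow> ((nat \<Rightarrow> bool) \<Rightarrow> bool) \<Rightarrow> nat \<Rightarrow> bool" where
  "relevant n \<Phi> k \<longleftrightarrow> (\<exists>s\<in>states n. \<Phi> (s(k := True)) \<noteq> \<Phi> (s(k := False)))"

definition coherent_system :: "nat \<Rightarrow> ((nat \<Rightarrow> bool) \<Rightarrow> bool) \<Rightarrow> bool" where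
  "coherent_system n \<Phi> \<longleftrightarrow> mono_on (states n) \<Phi> \<and> (\<forall>k\<in>{1..n}. relevant n \<Phi> k)"

definition paths :: "nat \<Rightarrow> ((nat \<Rightarrow> bool) \<Rightarrow> bool) \<Rightarrow> (nat \<Rightarrow> bool) set" where
  "paths n \<Phi> = {s \<in> states n. \<Phi> s}"

definition strongly_stable :: "nat \<Rightarrow> ((nat \<Rightarrow> bool) \<Rightarrow> bool) \<Rightarrow> bool" where
  "strongly_stable n \<Phi> \<longleftrightarrow>
     (\<forall>m\<in>paths n \<Phi>. \<forall>i\<in>{1..n}. \<forall>j\<in>{1..n}.
        j < i \<and> m i \<and> \<not> m j \<longrightarrow> m(i := False, j := True) \<in> paths n \<Phi>)"

(* Pi_pmf is the joint law of independent components; it is supported in states n. *)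

definition reliability :: "nat \<Rightarrow> ((nat \<Rightarrow> bool) \<Rightarrow> bool) \<Rightarrow> (nat \<Rightarrow> real) \<Rightarrow> real" where
  "reliability n \<Phi> p =
     measure_pmf.prob (Pi_pmf {1..n} False (\<lambda>k. bernoulli_pmf (p k))) {s. \<Phi> s}"

end

theory Submission
  imports Defs
begin

text \<open>
  Condition on the states of the components other than \<open>i\<close> and \<open>j\<close>, and let \<open>b\<close> and \<open>c\<close> be the
  values of \<open>\<Phi>\<close> when only \<open>j\<close>, respectively only \<open>i\<close>, of these two works. The conditional reliability
  changes by \<open>(p i - p j) * (b - c)\<close> under the interchange, and strong stability says \<open>c \<le> b\<close>.
\<close>

lemma prob_bind_pmf:
  "measure_pmf.prob (bind_pmf M f) X = (\<integral>x. measure_pmf.prob (f x) X \<partial>measure_pmf M)"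
proof -
  have "ennreal (measure_pmf.prob (bind_pmf M f) X) = (\<integral>\<^sup>+x. ennreal (measure_pmf.prob (f x) X) \<partial>measure_pmf M)"
    by (simp flip: measure_pmf.emeasure_eq_measure)
  also have "\<dots> = ennreal (\<integral>x. measure_pmf.prob (f x) X \<partial>measure_pmf M)"
    by (intro nn_integral_eq_integral measure_pmf.integrable_const_bound[where B = 1]) auto
  finally show ?thesis
    by (simp add: integral_nonneg_AE)
qed

lemma prob_bind_bernoulli_pmf:
  assumes "x \<in> {0..1}"
  shows "measure_pmf.prob (bind_pmf (bernoulli_pmf x) f) X =
    x * measure_pmf.prob (f True) X + (1 - x) * measure_pmf.prob (f False) X"
  using assms by (simp add: prob_bind_pmf)

text \<open>By independence, components \<open>i\<close> and \<open>j\<close> can be drawn after all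
  others. The law left in the integral then involves neither \<open>p i\<close> nor
  \<open>p j\<close>.\<close>

lemma reliability_pivot:
  assumes "i \<in> {1..n}" "j \<in> {1..n}" "i \<noteq> j" "p i \<in> {0..1}" "p j \<in> {0..1}"
  shows "reliability n \<Phi> p =
    (\<integral>s. p i * (p j * of_bool (\<Phi> (s(j := True, i := True))) +
               (1 - p j) * of_bool (\<Phi> (s(j := False, i := True)))) +
         (1 - p i) * (p j * of_bool (\<Phi> (s(j := True, i := False))) +
               (1 - p j) * of_bool (\<Phi> (s(j := False, i := False))))
     \<partial>measure_pmf (Pi_pmf ({1..n} - {i, j}) False (\<lambda>k. bernoulli_pmf (p k))))"
proof -
  define A where "A = {1..n} - {i, j}"
  have "{1..n} = insert i (insert j A)" "finite A" "i \<notin> insert j A" "j \<notin> A"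
    using assms by (auto simp: A_def)
  then have "Pi_pmf {1..n} False (\<lambda>k. bernoulli_pmf (p k)) =
      do {s \<leftarrow> Pi_pmf A False (\<lambda>k. bernoulli_pmf (p k)); x \<leftarrow> bernoulli_pmf (p i);
          y \<leftarrow> bernoulli_pmf (p j); return_pmf (s(j := y, i := x))}"
    \<comment> \<open>\<open>Pi_pmf_insert'\<close> draws the inserted component before the rest, so
      the draw of \<open>s\<close> has to be commuted past \<open>x\<close> and \<open>y\<close>;
      fixing its law keeps the rewriting from looping.\<close>
    by (simp add: Pi_pmf_insert' bind_assoc_pmf bind_return_pmf
        bind_commute_pmf[of "Pi_pmf A False (\<lambda>k. bernoulli_pmf (p k))"])
  then show ?thesis
    using assms(4,5) unfolding reliability_def A_def[symmetric]
    by (simp add: prob_bind_pmf[of "Pi_pmf _ _ _"] prob_bind_bernoulli_pmf indicator_def)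
qed

text \<open>Stability is applied to the updated tuple, so \<open>s\<close> itself may be any state;
  the updates have the shape met in the pivot integrand.\<close>

lemma strongly_stable_shift:
  assumes "strongly_stable n \<Phi>" "i \<in> {1..n}" "j \<in> {1..n}" "j < i"
    and "s \<in> states n" "\<Phi> (s(j := False, i := True))"
  shows "\<Phi> (s(j := True, i := False))"
proof -
  have "s(j := False, i := True) \<in> paths n \<Phi>"
    using assms by (auto simp: paths_def states_def PiE_dflt_def)
  then have "(s(j := False, i := True))(i := False, j := True) \<in> paths n \<Phi>"
    using assms unfolding strongly_stable_def by (metis fun_upd_same fun_upd_other less_irrefl)
  moreover have "(s(j := False, i := True))(i := False, j := True) = s(j := True, i := False)"
    using assms(4) by (auto simp: fun_eq_iff)
  ultimately show ?thesis
    by (simp only: paths_def mem_Collect_eq)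
qed

theorem proposition3p4:
  fixes n i j :: nat and \<Phi> :: "(nat \<Rightarrow> bool) \<Rightarrow> bool" and p :: "nat \<Rightarrow> real"
  assumes "coherent_system n \<Phi>"
    and "strongly_stable n \<Phi>"
    and "\<forall>k\<in>{1..n}. p k \<in> {0..1}"
    and "i \<in> {1..n}" and "j \<in> {1..n}" and "j < i"
  shows "p i \<ge> p j \<longrightarrow> reliability n \<Phi> (p(j := p i, i := p j)) \<ge> reliability n \<Phi> p"
proof
  assume le: "p j \<le> p i"
  define p' where "p' = p(j := p i, i := p j)"
  define A where "A = {1..n} - {i, j}"
  define M where "M = Pi_pmf A False (\<lambda>k. bernoulli_pmf (p k))"
  \<comment> \<open>The pivot integrand, with \<open>x\<close> and \<open>y\<close> for the
    probabilities of \<open>i\<close> and \<open>j\<close>: the interchange only swaps these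
    arguments.\<close>
  define F where "F x y s = x * (y * of_bool (\<Phi> (s(j := True, i := True))) +
               (1 - y) * of_bool (\<Phi> (s(j := False, i := True)))) +
         (1 - x) * (y * of_bool (\<Phi> (s(j := True, i := False))) +
               (1 - y) * of_bool (\<Phi> (s(j := False, i := False))))" for x y :: real and s
  have p': "p' i = p j" "p' j = p i"
    using assms(6) by (auto simp: p'_def)
  \<comment> \<open>\<open>p\<close> and \<open>p'\<close> agree on \<open>A\<close>, so both
    integrals are over the same law.\<close>
  have M': "Pi_pmf A False (\<lambda>k. bernoulli_pmf (p' k)) = M"
    unfolding M_def by (rule Pi_pmf_cong) (auto simp: A_def p'_def)
  \<comment> \<open>The default \<open>False\<close> outside \<open>A\<close> also fills positions
    \<open>i\<close> and \<open>j\<close>.\<close>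
  have states: "s \<in> states n" if "s \<in> set_pmf M" for s
    using that set_Pi_pmf_subset[of A False]
    by (fastforce simp: M_def states_def PiE_dflt_def A_def)
  have "finite (set_pmf M)"
    unfolding M_def A_def by (subst set_Pi_pmf) (auto intro!: finite_PiE_dflt)
  then have int: "integrable (measure_pmf M) (F x y)" for x y
    by (rule integrable_measure_pmf_finite)
  have "F (p i) (p j) s \<le> F (p j) (p i) s" if "s \<in> set_pmf M" for s
  proof -
    have "of_bool (\<Phi> (s(j := False, i := True))) \<le> (of_bool (\<Phi> (s(j := True, i := False))) :: real)"
      using strongly_stable_shift[OF assms(2,4-6) states[OF that]] by simp
    then have "0 \<le> (p i - p j) *
        (of_bool (\<Phi> (s(j := True, i := False))) - of_bool (\<Phi> (s(j := False, i := True))))"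
      using le by simp
    \<comment> \<open>The weights \<open>x * y\<close> and \<open>(1 - x) * (1 - y)\<close> are
      symmetric, so the terms where \<open>i\<close> and \<open>j\<close> agree cancel.\<close>
    also have "\<dots> = F (p j) (p i) s - F (p i) (p j) s"
      unfolding F_def by (simp only: algebra_simps)
    finally show ?thesis
      by simp
  qed
  then have "(\<integral>s. F (p i) (p j) s \<partial>measure_pmf M) \<le> (\<integral>s. F (p j) (p i) s \<partial>measure_pmf M)"
    by (intro integral_mono_AE int) (simp add: AE_measure_pmf_iff)
  moreover have "reliability n \<Phi> p = (\<integral>s. F (p i) (p j) s \<partial>measure_pmf M)"
    unfolding F_def M_def A_def using assms by (intro reliability_pivot) auto
  moreover have "reliability n \<Phi> p' = (\<integral>s. F (p j) (p i) s \<partial>measure_pmf M)"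
    unfolding F_def M'[symmetric] p'[symmetric] A_def
    using assms by (intro reliability_pivot) (auto simp: p'_def)
  ultimately show "reliability n \<Phi> p \<le> reliability n \<Phi> (p(j := p i, i := p j))"
    by (simp add: p'_def)
qed

end
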